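(* (i) $\mathcal{S}_{0}=\mathcal{S}_{1}=\mathcal{S}_{2}=0$ and, for every $n \geq 3$, \[\mathcal{S}_{n}=\sum_{d=2}^{n-1} (d-1) V_{d,n-1}.\] (ii) $\mathcal{T}_{0}=0$ and, for every $n \geq 1$, \[\mathcal{T}_{n}=\mathcal{S}_{n-1}+Q_{n}.\]
   Context: Let $S=\begin{pmatrix}0&-1\\1&0\end{pmatrix}$ and $T=\begin{pmatrix}1&1\\0&1\end{pmatrix}$. For $n\ge 1$ and integers $a_1,\ldots,a_n$, set \[M_n(a_1,\ldots,a_n):=\begin{pmatrix} a_n & -1\\ 1 & 0\end{pmatrix}\begin{pmatrix} a_{n-1} & -1\\ 1 & 0\end{pmatrix}\cdots\begin{pmatrix} a_1 & -1\\ 1 & 0\end{pmatrix}\in SL_2(\mathbb{Z}).\] For $M\in SL_2(\mathbb{Z})$, a solution of $(E_M)$ of size $n$ is an $n$-tuple $(a_1,\ldots,a_n)$ of positive integers such that $M_n(a_1,\ldots,a_n)=\pm M$. A $\lambda$-quiddity is a solution of $(E_{Id})$. For $n\ge 0$, $\mathcal{S}_n$ is the number of solutions of $(E_S)$ of size $n+2$, and $\mathcal{T}_n$ is the number of solutions of $(E_T)$ of size $n+2$. $Q_0:=1$ and, for $n\ge1$, $Q_n$ is the number of $\lambda$-quiddities of size $n+2$. For $n,k\ge 1$, $V_{k,n}$ is the number of $\lambda$-quiddities of size $n+2$ whose last component equals $k$. *)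

theory Defs
  imports "HOL-Analysis.Analysis"
begin

definition mat2 :: "int \<Rightarrow> int \<Rightarrow> int \<Rightarrow> int \<Rightarrow> int^2^2" where
  "mat2 a b c d = vector [vector [a, b], vector [c, d]]"

definition S_mat :: "int^2^2" where
  "S_mat = mat2 0 (-1) 1 0"

definition T_mat :: "int^2^2" where
  "T_mat = mat2 1 1 0 1"

text \<open>The tuple \<open>(a_1, \<dots>, a_n)\<close> is the list \<open>[a_1, \<dots>, a_n]\<close>. The factor of \<open>a_1\<close> is the
  rightmost one in the product.\<close>

primrec M_n :: "int list \<Rightarrow> int^2^2" where
  "M_n [] = mat 1"
| "M_n (a # as) = M_n as ** mat2 a (-1) 1 0"

definition solutions :: "int^2^2 \<Rightarrow> nat \<Rightarrow> int list set" where
  "solutions M n =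
     {as. length as = n \<and> (\<forall>a\<in>set as. a > 0) \<and> (M_n as = M \<or> M_n as = - M)}"

definition quiddities :: "nat \<Rightarrow> int list set" where
  "quiddities n = solutions (mat 1) n"

definition S_num :: "nat \<Rightarrow> nat" where
  "S_num n = card (solutions S_mat (n + 2))"

definition T_num :: "nat \<Rightarrow> nat" where
  "T_num n = card (solutions T_mat (n + 2))"

definition Q_num :: "nat \<Rightarrow> nat" where
  "Q_num n = (if n = 0 then 1 else card (quiddities (n + 2)))"

definition V_num :: "nat \<Rightarrow> nat \<Rightarrow> nat" where
  "V_num k n = card {as \<in> quiddities (n + 2). last as = int k}"

text \<open>The sets counted above are finite, so \<open>card\<close> is their true number of elements; see
  \<open>finite_solutions\<close> below. The proof shows, more generally, that there are finitely many
  tuples of given length and given matrix whose entries are bounded below: an entry of absolute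
  value at most 1 allows a reduction to a shorter tuple, and if there is none then the matrix
  bounds all entries.\<close>

lemma mat2_eq_iff: "A = (B::int^2^2) \<longleftrightarrow>
    A$1$1 = B$1$1 \<and> A$1$2 = B$1$2 \<and> A$2$1 = B$2$1 \<and> A$2$2 = B$2$2"
  by (auto simp: vec_eq_iff forall_2)

lemma mat2_nth [simp]:
  "mat2 a b c d $ 1 $ 1 = a" "mat2 a b c d $ 1 $ 2 = b"
  "mat2 a b c d $ 2 $ 1 = c" "mat2 a b c d $ 2 $ 2 = d"
  by (simp_all add: mat2_def vector_2)

lemma mat2_mult_nth:
  "((A::int^2^2) ** B) $ i $ j = A$i$1 * B$1$j + A$i$2 * B$2$j"
  by (simp add: matrix_matrix_mult_def sum_2)

lemma mat2_one_nth:
  "(mat 1 :: int^2^2)$1$1 = 1" "(mat 1 :: int^2^2)$1$2 = 0"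
  "(mat 1 :: int^2^2)$2$1 = 0" "(mat 1 :: int^2^2)$2$2 = 1"
  by (simp_all add: mat_def)

lemmas mat2_simps = mat2_eq_iff mat2_mult_nth mat2_one_nth

lemma mat2_minus_mult:
  "(- A) ** B = - ((A::int^2^2) ** (B::int^2^2))" "A ** (- B) = - ((A::int^2^2) ** (B::int^2^2))"
  by (simp_all add: mat2_simps)

lemma M_n_append: "M_n (as @ bs) = M_n bs ** M_n as"
  by (induction as) (simp_all add: matrix_mul_assoc)

lemma M_n_reduce_one:
  "M_n (xs @ b # 1 # c # ys) = M_n (xs @ (b - 1) # (c - 1) # ys)"
proof -
  have "mat2 c (-1) 1 0 ** mat2 1 (-1) 1 0 ** mat2 b (-1) 1 0 =
        mat2 (c - 1) (-1) 1 0 ** mat2 (b - 1) (-1) 1 0"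
    by (simp add: mat2_simps algebra_simps)
  then show ?thesis
    by (simp add: M_n_append flip: matrix_mul_assoc)
qed

lemma M_n_reduce_minus_one:
  "M_n (xs @ b # (-1) # c # ys) = - M_n (xs @ (b + 1) # (c + 1) # ys)"
proof -
  have "mat2 c (-1) 1 0 ** mat2 (-1) (-1) 1 0 ** mat2 b (-1) 1 0 =
        - (mat2 (c + 1) (-1) 1 0 ** mat2 (b + 1) (-1) 1 0)"
    by (simp add: mat2_simps algebra_simps)
  then show ?thesis
    by (simp add: M_n_append mat2_minus_mult flip: matrix_mul_assoc)
qed

lemma M_n_reduce_zero:
  "M_n (xs @ b # 0 # c # ys) = - M_n (xs @ (b + c) # ys)"
proof -
  have "mat2 c (-1) 1 0 ** mat2 0 (-1) 1 0 ** mat2 b (-1) 1 0 = - mat2 (b + c) (-1) 1 0"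
    by (simp add: mat2_simps algebra_simps)
  then show ?thesis
    by (simp add: M_n_append mat2_minus_mult flip: matrix_mul_assoc)
qed

lemma M_n_bounds_entries:
  assumes "\<forall>a\<in>set as. \<bar>a\<bar> \<ge> 2"
  shows "\<bar>M_n as $ 2 $ 1\<bar> < \<bar>M_n as $ 1 $ 1\<bar> \<and> (\<forall>a\<in>set as. \<bar>a\<bar> \<le> \<bar>M_n as $ 1 $ 1\<bar> + 1)"
  using assms
proof (induction as rule: rev_induct)
  case Nil
  then show ?case by (simp add: mat2_one_nth)
next
  case (snoc a as)
  define p r where "p = M_n as $ 1 $ 1" and "r = M_n as $ 2 $ 1"
  have *: "M_n (as @ [a]) $ 1 $ 1 = a * p - r" "M_n (as @ [a]) $ 2 $ 1 = p"
    by (simp_all add: M_n_append mat2_mult_nth mat2_one_nth p_def r_def)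
  have IH: "\<bar>r\<bar> < \<bar>p\<bar>" "\<forall>a\<in>set as. \<bar>a\<bar> \<le> \<bar>p\<bar> + 1" and a: "\<bar>a\<bar> \<ge> 2"
    using snoc by (simp_all add: p_def r_def)
  have tri: "\<bar>a\<bar> * \<bar>p\<bar> \<le> \<bar>a * p - r\<bar> + \<bar>r\<bar>"
    unfolding abs_mult [symmetric] by linarith
  have "2 * \<bar>p\<bar> \<le> \<bar>a\<bar> * \<bar>p\<bar>"
    using a by (intro mult_right_mono) auto
  with tri IH(1) have grow: "\<bar>p\<bar> < \<bar>a * p - r\<bar>" by linarith
  have "(\<bar>a\<bar> - 1) * 1 \<le> (\<bar>a\<bar> - 1) * \<bar>p\<bar>"
    using a IH(1) by (intro mult_left_mono) auto
  with tri IH(1) have "\<bar>a\<bar> \<le> \<bar>a * p - r\<bar> + 1"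
    by (simp add: algebra_simps)
  with grow IH(2) show ?case
    unfolding * by fastforce
qed

lemma finite_M_n_fibre:
  "finite {as. length as = n \<and> (\<forall>a\<in>set as. a \<ge> - K) \<and> M_n as = M}"
proof (induction n arbitrary: K M rule: less_induct)
  case (less n)
  define F where "F m L N = {as. length as = m \<and> (\<forall>a\<in>set as. a \<ge> - L) \<and> M_n as = N}"
    for m :: nat and L :: int and N :: "int^2^2"
  have fin: "finite (F m L N)" if "m < n" for m L N
    using less[OF that] by (simp add: F_def)
  define big where "big = {as. set as \<subseteq> {- (\<bar>M$1$1\<bar> + 1)..\<bar>M$1$1\<bar> + 1} \<and> length as = n}"
  define inv where "inv a = mat2 0 1 (-1) a" for a
  define ends where "ends = (\<Union>a\<in>{-1, 0, 1}.
     Cons a ` F (n - 1) K (M ** inv a) \<union> (\<lambda>xs. xs @ [a]) ` F (n - 1) K (inv a ** M))"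
  define one where "one = (\<lambda>(i, l). take i l @ (l!i + 1) # 1 # (l!Suc i + 1) # drop (i + 2) l)
     ` ({..n} \<times> F (n - 1) (K + 1) M)"
  define mone where
    "mone = (\<lambda>(i, l). take i l @ (l!i - 1) # (-1) # (l!Suc i - 1) # drop (i + 2) l)
     ` ({..n} \<times> F (n - 1) K (- M))"
  define zero where "zero = (\<Union>l\<in>F (n - 2) (2 * K) (- M). \<Union>i\<in>{..n}.
     (\<lambda>b. take i l @ b # 0 # (l!i - b) # drop (Suc i) l) ` {- K..l!i + K})"
  have "finite big"
    unfolding big_def by (rule finite_lists_length_eq) simp
  show ?case
  proof (cases "n = 0")
    case True
    then show ?thesis by (auto intro: finite_subset[of _ "{[]}"])
  next
    case n: False
    have fin_small: "finite ends" "finite one" "finite mone"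
      using n by (auto simp: ends_def one_def mone_def intro!: fin finite_imageI finite_cartesian_product)
    have fin_zero: "finite zero"
      using n by (auto simp: zero_def intro!: fin)
    have "as \<in> big \<union> ends \<union> one \<union> mone \<union> zero" if as: "as \<in> F n K M" for as
    proof (cases "\<forall>a\<in>set as. \<bar>a\<bar> \<ge> 2")
      case True
      from M_n_bounds_entries[OF this] as have "as \<in> big"
        by (fastforce simp: big_def F_def abs_le_iff)
      then show ?thesis by simp
    next
      case False
      then obtain a where "a \<in> set as" and a: "a \<in> {-1, 0, 1}" by fastforce
      then obtain xs ys where as_eq: "as = xs @ a # ys" by (meson split_list)
      have inv: "mat2 a (-1) 1 0 ** inv a = mat 1" "inv a ** mat2 a (-1) 1 0 = mat 1"
        by (simp_all add: inv_def mat2_simps)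
      consider "xs = []" | "ys = []" | xs' b c ys' where "xs = xs' @ [b]" "ys = c # ys'"
        by (metis rev_exhaust list.exhaust)
      then show ?thesis
      proof cases
        case 1
        have "M ** inv a = M_n ys"
          using as 1 inv by (auto simp: F_def as_eq simp flip: matrix_mul_assoc)
        then have "ys \<in> F (n - 1) K (M ** inv a)"
          using as 1 by (auto simp: F_def as_eq)
        then have "as \<in> ends"
          unfolding ends_def as_eq 1 using a by blast
        then show ?thesis by simp
      next
        case 2
        have "inv a ** M = M_n xs"
          using as 2 inv by (auto simp: F_def as_eq M_n_append matrix_mul_assoc)
        then have "xs \<in> F (n - 1) K (inv a ** M)"
          using as 2 by (auto simp: F_def as_eq)
        then have "as \<in> ends"
          unfolding ends_def as_eq 2 using a by blast
        then show ?thesis by simp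
      next
        case 3
        note as_eq' = as_eq[unfolded 3, simplified]
        have len: "length xs' \<in> {..n}" "n = length xs' + length ys' + 3"
          using as by (auto simp: F_def as_eq')
        from a consider "a = 1" | "a = -1" | "a = 0" by blast
        then show ?thesis
        proof cases
          case 1
          define l where "l = xs' @ (b - 1) # (c - 1) # ys'"
          have l: "l \<in> F (n - 1) (K + 1) M"
          proof -
            have "\<forall>x\<in>set as. - K - 1 \<le> x"
              using as by (fastforce simp: F_def)
            then show ?thesis
              using as by (auto simp: F_def as_eq' 1 l_def M_n_reduce_one)
          qed
          have "as = (\<lambda>(i, l). take i l @ (l!i + 1) # 1 # (l!Suc i + 1) # drop (i + 2) l)
                       (length xs', l)"
            by (simp add: as_eq' 1 l_def nth_append)
          then have "as \<in> one"
            unfolding one_def using l len(1) by blast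
          then show ?thesis by simp
        next
          case 2
          define l where "l = xs' @ (b + 1) # (c + 1) # ys'"
          have l: "l \<in> F (n - 1) K (- M)"
            using as by (auto simp: F_def as_eq' 2 l_def M_n_reduce_minus_one)
          have "as = (\<lambda>(i, l). take i l @ (l!i - 1) # (-1) # (l!Suc i - 1) # drop (i + 2) l)
                       (length xs', l)"
            by (simp add: as_eq' 2 l_def nth_append)
          then have "as \<in> mone"
            unfolding mone_def using l len(1) by blast
          then show ?thesis by simp
        next
          case 3
          show ?thesis
          proof (cases "K \<ge> 0")
            case True
            define l where "l = xs' @ (b + c) # ys'"
            have l: "l \<in> F (n - 2) (2 * K) (- M)"
              using as True by (force simp: F_def as_eq' 3 l_def M_n_reduce_zero)
            have eq: "as = (\<lambda>b. take (length xs') l @ b # 0 # (l!length xs' - b)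
                           # drop (Suc (length xs')) l) b"
              by (simp add: as_eq' 3 l_def nth_append)
            have b: "b \<in> {- K..l!length xs' + K}"
              using as by (auto simp: F_def as_eq' l_def)
            have "as \<in> zero"
              unfolding zero_def using l len(1) eq b by blast
            then show ?thesis by simp
          next
            case False
            then show ?thesis using as by (auto simp: F_def as_eq' 3)
          qed
        qed
      qed
    qed
    then have "F n K M \<subseteq> big \<union> ends \<union> one \<union> mone \<union> zero" by blast
    then have "finite (F n K M)"
      by (rule finite_subset) (use \<open>finite big\<close> fin_small fin_zero in simp)
    then show ?thesis by (simp add: F_def)
  qed
qed

lemma finite_solutions: "finite (solutions M n)"
proof (rule finite_subset)
  show "solutions M n \<subseteq>
      {as. length as = n \<and> (\<forall>a\<in>set as. a \<ge> - 0) \<and> M_n as = M} \<union>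
      {as. length as = n \<and> (\<forall>a\<in>set as. a \<ge> - 0) \<and> M_n as = - M}"
    by (auto simp: solutions_def less_imp_le)
qed (simp only: finite_Un finite_M_n_fibre)

end

theory Submission
  imports Defs
begin

text \<open>Both formulas come from dropping positivity at a single entry of a \<open>\<lambda>\<close>-quiddity. Write
  \<open>M(a)\<close> for the matrix with rows \<open>(a, -1)\<close> and \<open>(1, 0)\<close>, so that \<open>S = M(0)\<close> and \<open>T M(a) = M(a + 1)\<close>.

  Since \<open>S\<close> is its own inverse up to sign, \<open>(a\<^sub>1, \<dots>, a\<^sub>n)\<close> solves \<open>(E_S)\<close> iff
  \<open>(a\<^sub>1, \<dots>, a\<^sub>n, 0)\<close> solves \<open>(E_Id)\<close>. The equation \<open>(E_Id)\<close> is invariant under cyclic shifts, and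
  a zero between two entries can be removed by adding these (\<open>M_n_reduce_zero\<close>). So the
  condition is that \<open>(a\<^sub>2, \<dots>, a\<^bsub>n-1\<^esub>, a\<^sub>n + a\<^sub>1)\<close> is a quiddity
  (\<open>solves_S_iff_merge_ends\<close>), and a quiddity with last entry \<open>d\<close> arises from the \<open>d - 1\<close>
  ways to write \<open>d\<close> as a sum of two positive integers. This gives \<open>card_solutions_S\<close>. The
  range of \<open>d\<close> in (i) and the vanishing of the first values both come from one
  bound: the entries of a quiddity of size \<open>m\<close> are at most \<open>m - 2\<close> (\<open>pm_id_entry_le\<close>).

  Likewise \<open>(a\<^sub>1, \<dots>, a\<^sub>n)\<close> solves \<open>(E_T)\<close> iff lowering \<open>a\<^sub>n\<close> by 1 gives a solution of
  \<open>(E_Id)\<close>. The lowered tuple is a quiddity if \<open>a\<^sub>n \<ge> 2\<close>; if \<open>a\<^sub>n = 1\<close> it ends in 0, and then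
  its other entries solve \<open>(E_S)\<close>. These are the two summands in (ii).\<close>

section \<open>Tuples whose matrix is the identity up to sign\<close>

text \<open>The entries are not required to be positive: zeros occur in the intermediate tuples of
  every argument below.\<close>

definition pm_id :: "int list \<Rightarrow> bool" where
  "pm_id as \<longleftrightarrow> M_n as = mat 1 \<or> M_n as = - mat 1"

lemma quiddities_iff:
  "as \<in> quiddities n \<longleftrightarrow> length as = n \<and> (\<forall>a\<in>set as. a > 0) \<and> pm_id as"
  by (simp add: quiddities_def solutions_def pm_id_def)

lemma M_n_snoc: "M_n (as @ [a]) = mat2 a (-1) 1 0 ** M_n as"
  by (simp add: M_n_append)

lemma pm_id_rotate1:
  assumes "pm_id (a # as)"
  shows "pm_id (as @ [a])"
proof -
  have "mat2 a (-1) 1 0 ** mat2 0 1 (-1) a = mat 1"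
    by (simp add: mat2_simps)
  moreover from this have
    "M_n (as @ [a]) = mat2 a (-1) 1 0 ** M_n (a # as) ** mat2 0 1 (-1) a"
    by (simp add: M_n_snoc flip: matrix_mul_assoc)
  ultimately show ?thesis
    using assms by (auto simp: pm_id_def mat2_minus_mult simp del: M_n.simps)
qed

lemma pm_id_append_commute: "pm_id (xs @ ys) \<longleftrightarrow> pm_id (ys @ xs)"
proof -
  have "pm_id (ys @ xs)" if "pm_id (xs @ ys)" for xs ys
    using that
  proof (induction xs arbitrary: ys)
    case (Cons x xs)
    then show ?case
      using pm_id_rotate1[of x "xs @ ys"] by fastforce
  qed simp
  then show ?thesis by blast
qed

lemma pm_id_remove_zero: "pm_id (xs @ b # 0 # c # ys) \<longleftrightarrow> pm_id (xs @ (b + c) # ys)"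
  unfolding pm_id_def M_n_reduce_zero by (metis minus_minus)

lemma pm_id_remove_one:
  "pm_id (xs @ b # 1 # c # ys) \<longleftrightarrow> pm_id (xs @ (b - 1) # (c - 1) # ys)"
  by (simp add: pm_id_def M_n_reduce_one)

section \<open>The entries of a quiddity are bounded by its size\<close>

text \<open>If all entries were at least 2, the lower left entry of \<open>M_n\<close>, which is the upper left
  entry for the tuple without its last component, would be nonzero.\<close>

lemma pm_id_small_entry:
  assumes "pm_id as" "as \<noteq> []" "\<forall>a\<in>set as. a \<ge> 0"
  shows "\<exists>a\<in>set as. a = 0 \<or> a = 1"
proof (rule ccontr)
  assume no_small: "\<not> ?thesis"
  obtain xs x where as: "as = xs @ [x]"
    using assms(2) by (metis rev_exhaust)
  have "\<bar>a\<bar> \<ge> 2" if "a \<in> set xs" for a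
  proof -
    have "a \<noteq> 0" "a \<noteq> 1" "a \<ge> 0" using that no_small assms(3) as by auto
    then show ?thesis by linarith
  qed
  then have "M_n xs $ 1 $ 1 \<noteq> 0"
    using M_n_bounds_entries[of xs] by force
  moreover have "M_n as $ 2 $ 1 = M_n xs $ 1 $ 1"
    by (simp add: as M_n_snoc mat2_mult_nth)
  moreover have "M_n as $ 2 $ 1 = 0"
    using assms(1) by (auto simp: pm_id_def mat2_one_nth)
  ultimately show False by simp
qed

lemma rotate_to_second:
  assumes "e \<in> set as" "length as \<ge> 3"
  obtains us vs b c ys where "as = us @ vs" "vs @ us = b # e # c # ys"
proof -
  obtain xs zs where as: "as = xs @ e # zs"
    using assms(1) by (meson split_list)
  show ?thesis
  proof (cases xs rule: rev_cases)
    case Nil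
    then have "length zs \<ge> 2" using as assms(2) by simp
    then obtain c ys where zs: "zs = c # ys" "ys \<noteq> []"
      by (cases zs; cases "tl zs") auto
    then show ?thesis
      using that[of "e # c # butlast ys" "[last ys]" "last ys" c "butlast ys"] as Nil by simp
  next
    case (snoc us b)
    then have "zs @ us \<noteq> []" using as assms(2) by auto
    then obtain c ys where "zs @ us = c # ys" by (cases "zs @ us") auto
    then show ?thesis
      using that[of us "b # e # zs"] as snoc by simp
  qed
qed

text \<open>A 0 or a 1 can be shifted to an inner position and removed there. Removing a 0 shortens the
  tuple by two and raises the entry that absorbs both neighbours; removing a 1 shortens it by one
  and lowers the two neighbours by 1. Neither step breaks the bound when it is undone. Zeros are
  admitted because a neighbour of a 1 may
  itself be 1, and they are removed first so that no entry becomes negative.\<close>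

lemma pm_id_entry_le:
  assumes "pm_id as" "\<forall>a\<in>set as. a \<ge> 0" "x \<in> set as"
  shows "x \<le> int (length as) - 2"
  using assms
proof (induction as arbitrary: x rule: length_induct)
  case (1 as)
  have IH: "y \<le> int (length l) - 2"
    if "pm_id l" "\<forall>a\<in>set l. a \<ge> 0" "length l < length as" "y \<in> set l" for l y
    using "1.IH" that by blast
  note pm = \<open>pm_id as\<close> and nonneg = \<open>\<forall>a\<in>set as. a \<ge> 0\<close> and x = \<open>x \<in> set as\<close>
  have "as \<noteq> []" using x by auto
  then consider a where "as = [a]" | a b where "as = [a, b]" | "length as \<ge> 3"
    by (cases as; cases "tl as"; cases "tl (tl as)") auto
  then show ?case
  proof cases
    case (1 a)
    then show ?thesis using pm by (simp add: pm_id_def mat2_simps)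
  next
    case (2 a b)
    then show ?thesis using pm x by (auto simp: pm_id_def mat2_simps)
  next
    case 3
    define e :: int where "e = (if 0 \<in> set as then 0 else 1)"
    have "e \<in> set as"
      using pm_id_small_entry[OF pm \<open>as \<noteq> []\<close> nonneg] by (auto simp: e_def)
    then obtain us vs b c ys where as: "as = us @ vs" and rot: "vs @ us = b # e # c # ys"
      using rotate_to_second 3 by metis
    have pm': "pm_id (b # e # c # ys)"
      using pm pm_id_append_commute[of us vs] by (simp add: as rot)
    have "set as = set (vs @ us)" "length as = length (vs @ us)"
      by (auto simp: as)
    then have set: "set as = insert e (insert b (insert c (set ys)))"
      and len: "length as = length ys + 3"
      by (auto simp: rot)
    show ?thesis
    proof (cases "0 \<in> set as")
      case True
      then have "pm_id ((b + c) # ys)"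
        using pm' pm_id_remove_zero[of "[]" b c ys] by (simp add: e_def)
      moreover have "\<forall>a\<in>set ((b + c) # ys). a \<ge> 0"
        using nonneg by (simp add: set)
      ultimately have le: "y \<le> int (length ys) - 1" if "y \<in> set ((b + c) # ys)" for y
        using IH[of "(b + c) # ys" y] that len by simp
      have "b \<ge> 0" "c \<ge> 0" using nonneg by (simp_all add: set)
      moreover have "e = 0" using True by (simp add: e_def)
      moreover have "b + c \<le> int (length ys) - 1" by (rule le) simp
      moreover have "x = e \<or> x = b \<or> x = c \<or> x \<le> int (length ys) - 1"
        using x le by (auto simp: set)
      ultimately show ?thesis
        unfolding len by linarith
    next
      case False
      then have e: "e = 1" by (simp add: e_def)
      have pos: "\<forall>a\<in>set as. a \<ge> 1"
        using False nonneg by (metis int_one_le_iff_zero_less order_le_less)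
      have "pm_id ((b - 1) # (c - 1) # ys)"
        using pm' pm_id_remove_one[of "[]" b c ys] by (simp add: e)
      moreover have "\<forall>a\<in>set ((b - 1) # (c - 1) # ys). a \<ge> 0"
        using pos nonneg by (simp add: set)
      ultimately have le: "y \<le> int (length ys)" if "y \<in> set ((b - 1) # (c - 1) # ys)" for y
        using IH[of "(b - 1) # (c - 1) # ys" y] that len by simp
      have "b - 1 \<le> int (length ys)" "c - 1 \<le> int (length ys)" by (rule le, simp)+
      moreover have "x = e \<or> x = b \<or> x = c \<or> x \<le> int (length ys)"
        using x le by (auto simp: set)
      ultimately show ?thesis
        unfolding len e by linarith
    qed
  qed
qed

lemma quiddity_last:
  assumes "q \<in> quiddities (Suc n)"
  shows "0 < last q" "last q \<le> int n - 1"
proof -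
  have "q \<noteq> []" using assms by (auto simp: quiddities_iff)
  then have "last q \<in> set q" by simp
  then show "0 < last q" "last q \<le> int n - 1"
    using assms pm_id_entry_le[of q "last q"] by (auto simp: quiddities_iff less_imp_le)
qed

section \<open>Counting the solutions for \<open>S\<close>\<close>

lemma solves_S_iff: "M_n as = S_mat \<or> M_n as = - S_mat \<longleftrightarrow> pm_id (as @ [0])"
  by (auto simp: pm_id_def M_n_snoc S_mat_def mat2_simps)

lemma solves_S_iff_merge_ends:
  "M_n (b # xs @ [c]) = S_mat \<or> M_n (b # xs @ [c]) = - S_mat \<longleftrightarrow> pm_id (xs @ [c + b])"
  using pm_id_append_commute[of "[b]" "xs @ [c, 0]"] pm_id_remove_zero[of xs c b "[]"]
  by (simp add: solves_S_iff del: M_n.simps)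

lemma bij_betw_solutions_S:
  "bij_betw (\<lambda>(q, b). b # butlast q @ [last q - b])
     (SIGMA q:quiddities (Suc n). {1..<last q}) (solutions S_mat (n + 2))"
proof (rule bij_betw_byWitness[where f' = "\<lambda>as. (butlast (tl as) @ [last as + hd as], hd as)"])
  let ?A = "SIGMA q:quiddities (Suc n). {1..<last q}"
  have A: "\<exists>xs d b. p = (xs @ [d], b) \<and> xs @ [d] \<in> quiddities (Suc n) \<and> 1 \<le> b \<and> b < d"
    if "p \<in> ?A" for p
  proof -
    obtain q b where p: "p = (q, b)" "q \<in> quiddities (Suc n)" "1 \<le> b" "b < last q"
      using \<open>p \<in> ?A\<close> by auto
    then have "q = butlast q @ [last q]"
      by (cases q rule: rev_cases) (simp_all add: quiddities_iff)
    then show ?thesis using p by metis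
  qed
  have B: "\<exists>b xs c. as = b # xs @ [c]" if "as \<in> solutions S_mat (n + 2)" for as
  proof -
    have "length as = n + 2" using \<open>as \<in> _\<close> by (simp add: solutions_def)
    then obtain b zs where "as = b # zs" "zs \<noteq> []"
      by (cases as; cases "tl as") auto
    then show ?thesis by (metis rev_exhaust)
  qed
  show "\<forall>p\<in>?A. (\<lambda>as. (butlast (tl as) @ [last as + hd as], hd as))
      ((\<lambda>(q, b). b # butlast q @ [last q - b]) p) = p"
    using A by fastforce
  show "\<forall>as\<in>solutions S_mat (n + 2). (\<lambda>(q, b). b # butlast q @ [last q - b])
      (butlast (tl as) @ [last as + hd as], hd as) = as"
    using B by fastforce
  have "(\<lambda>(q, b). b # butlast q @ [last q - b]) p \<in> solutions S_mat (n + 2)" if p: "p \<in> ?A" for p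
  proof -
    obtain xs d b where "p = (xs @ [d], b)" "xs @ [d] \<in> quiddities (Suc n)" "1 \<le> b" "b < d"
      using A[OF p] by blast
    then show ?thesis
      using solves_S_iff_merge_ends[of b xs "d - b"]
      by (auto simp: solutions_def quiddities_iff simp del: M_n.simps)
  qed
  then show "(\<lambda>(q, b). b # butlast q @ [last q - b]) ` ?A \<subseteq> solutions S_mat (n + 2)"
    by blast
  have "(butlast (tl as) @ [last as + hd as], hd as) \<in> ?A"
    if as: "as \<in> solutions S_mat (n + 2)" for as
  proof -
    obtain b xs c where "as = b # xs @ [c]"
      using B[OF as] by blast
    then show ?thesis
      using solves_S_iff_merge_ends[of b xs c] as
      by (auto simp: solutions_def quiddities_iff simp del: M_n.simps)
  qed
  then show "(\<lambda>as. (butlast (tl as) @ [last as + hd as], hd as)) ` solutions S_mat (n + 2) \<subseteq> ?A"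
    by blast
qed

lemma finite_quiddities: "finite (quiddities n)"
  by (simp add: quiddities_def finite_solutions)

lemma card_solutions_S: "S_num n = (\<Sum>q\<in>quiddities (Suc n). nat (last q) - 1)"
proof -
  have "S_num n = card (SIGMA q:quiddities (Suc n). {1..<last q})"
    unfolding S_num_def using bij_betw_same_card[OF bij_betw_solutions_S] by simp
  also have "\<dots> = (\<Sum>q\<in>quiddities (Suc n). card {1..<last q})"
    by (rule card_SigmaI) (simp_all add: finite_quiddities)
  also have "\<dots> = (\<Sum>q\<in>quiddities (Suc n). nat (last q) - 1)"
    by (rule sum.cong) (simp_all add: nat_diff_distrib')
  finally show ?thesis .
qed

lemma S_num_eq_0:
  assumes "n \<le> 2"
  shows "S_num n = 0"
proof -
  have "nat (last q) - 1 = 0" if "q \<in> quiddities (Suc n)" for q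
    using quiddity_last[OF that] assms by simp
  then show ?thesis by (simp add: card_solutions_S)
qed

lemma S_num_eq_sum:
  assumes "n \<ge> 1"
  shows "S_num n = (\<Sum>d = 2..n - 1. (d - 1) * V_num d (n - 1))"
proof -
  let ?Q = "quiddities (Suc n)"
  have last: "nat (last q) \<in> {1..n - 1}" if "q \<in> ?Q" for q
    using quiddity_last[OF that] by auto
  have "S_num n = (\<Sum>d\<in>{1..n - 1}. \<Sum>q\<in>{q \<in> ?Q. nat (last q) = d}. nat (last q) - 1)"
    unfolding card_solutions_S
    by (rule sum.group[symmetric]) (use last in \<open>auto simp: finite_quiddities\<close>)
  also have "\<dots> = (\<Sum>d\<in>{1..n - 1}. (d - 1) * V_num d (n - 1))"
  proof (rule sum.cong)
    fix d assume "d \<in> {1..n - 1}"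
    have "{q \<in> ?Q. nat (last q) = d} = {q \<in> ?Q. last q = int d}"
      using quiddity_last(1) by force
    moreover have "n - 1 + 2 = Suc n" using assms by simp
    ultimately show "(\<Sum>q\<in>{q \<in> ?Q. nat (last q) = d}. nat (last q) - 1) = (d - 1) * V_num d (n - 1)"
      by (simp add: V_num_def)
  qed simp
  also have "\<dots> = (\<Sum>d = 2..n - 1. (d - 1) * V_num d (n - 1))"
    by (rule sum.mono_neutral_right) auto
  finally show ?thesis .
qed

section \<open>Counting the solutions for \<open>T\<close>\<close>

lemma solves_T_iff_lower_last:
  "M_n (as @ [a]) = T_mat \<or> M_n (as @ [a]) = - T_mat \<longleftrightarrow> pm_id (as @ [a - 1])"
  by (simp add: pm_id_def M_n_snoc T_mat_def mat2_simps left_diff_distrib) (smt (verit))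

text \<open>By \<open>solves_T_iff_lower_last\<close> the two parts are the solutions that end in 1 and those that end
  in a larger entry; hence the union is disjoint.\<close>

lemma solutions_T_eq:
  "solutions T_mat (Suc n) = (\<lambda>as. as @ [1]) ` solutions S_mat n \<union>
     (\<lambda>q. butlast q @ [last q + 1]) ` quiddities (Suc n)" (is "_ = ?S \<union> ?Q")
proof
  show "solutions T_mat (Suc n) \<subseteq> ?S \<union> ?Q"
  proof
    fix as assume as: "as \<in> solutions T_mat (Suc n)"
    then obtain xs a where snoc: "as = xs @ [a]"
      by (cases as rule: rev_cases) (auto simp: solutions_def)
    have pm: "pm_id (xs @ [a - 1])" and pos: "\<forall>x\<in>set xs. x > 0" "a > 0" "length xs = n"
      using as solves_T_iff_lower_last[of xs a] by (auto simp: solutions_def snoc)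
    show "as \<in> ?S \<union> ?Q"
    proof (cases "a = 1")
      case True
      then have "xs \<in> solutions S_mat n"
        using pm pos solves_S_iff[of xs] by (simp add: solutions_def)
      then show ?thesis by (simp add: snoc True)
    next
      case False
      then have "xs @ [a - 1] \<in> quiddities (Suc n)"
        using pm pos by (auto simp: quiddities_iff)
      then have "as \<in> ?Q" by (rule rev_image_eqI) (simp add: snoc)
      then show ?thesis by simp
    qed
  qed
  have "xs @ [1] \<in> solutions T_mat (Suc n)" if "xs \<in> solutions S_mat n" for xs
    using that solves_T_iff_lower_last[of xs 1] solves_S_iff[of xs] by (auto simp: solutions_def)
  moreover have "butlast q @ [last q + 1] \<in> solutions T_mat (Suc n)"
    if "q \<in> quiddities (Suc n)" for q
  proof (cases q rule: rev_cases)
    case (snoc xs a)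
    then show ?thesis
      using that solves_T_iff_lower_last[of xs "a + 1"] by (auto simp: solutions_def quiddities_iff)
  qed (use that in \<open>simp add: quiddities_iff\<close>)
  ultimately show "?S \<union> ?Q \<subseteq> solutions T_mat (Suc n)" by blast
qed

lemma card_solutions_T:
  "card (solutions T_mat (Suc n)) = card (solutions S_mat n) + card (quiddities (Suc n))"
proof -
  let ?f = "\<lambda>q::int list. butlast q @ [last q + 1]"
  have "xs @ [1] \<noteq> ?f q" if "q \<in> quiddities (Suc n)" for q xs
    using quiddity_last(1)[OF that] by simp
  then have "(\<lambda>as. as @ [1]) ` solutions S_mat n \<inter> ?f ` quiddities (Suc n) = {}"
    by blast
  moreover have "inj_on ?f (quiddities (Suc n))"
  proof (rule inj_onI)
    fix p q assume "p \<in> quiddities (Suc n)" "q \<in> quiddities (Suc n)" "?f p = ?f q"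
    then show "p = q"
      by (cases p rule: rev_cases; cases q rule: rev_cases) (auto simp: quiddities_iff)
  qed
  moreover have "inj_on (\<lambda>as. as @ [1]) (solutions S_mat n)"
    by (auto intro: inj_onI)
  ultimately show ?thesis
    by (simp add: solutions_T_eq card_Un_disjoint card_image finite_solutions finite_quiddities)
qed

lemma T_num_eq:
  assumes "n \<ge> 1"
  shows "T_num n = S_num (n - 1) + Q_num n"
proof -
  have "n - 1 + 2 = Suc n" using assms by simp
  then show ?thesis
    using assms card_solutions_T[of "Suc n"] by (simp add: T_num_def S_num_def Q_num_def)
qed

lemma T_num_0: "T_num 0 = 0"
proof -
  have "quiddities 2 = {}"
    using quiddity_last[of _ 1] by (force simp: numeral_2_eq_2)
  moreover have "solutions S_mat 1 = {}"
    by (auto simp: solutions_def length_Suc_conv S_mat_def mat2_simps)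
  ultimately show ?thesis
    using card_solutions_T[of 1] by (simp add: T_num_def numeral_2_eq_2)
qed

theorem mainTheorem3:
  shows "(S_num 0 = 0 \<and> S_num 1 = 0 \<and> S_num 2 = 0 \<and>
          (\<forall>n\<ge>3. S_num n = (\<Sum>d = 2..n - 1. (d - 1) * V_num d (n - 1)))) \<and>
         (T_num 0 = 0 \<and> (\<forall>n\<ge>1. T_num n = S_num (n - 1) + Q_num n))"
  using S_num_eq_0 S_num_eq_sum T_num_0 T_num_eq by simp

end
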